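(* Let $G$ be a group. Then $G$ is a VZ-group if and only if $U(G)=[G,G]$.
   Context: All groups are finite and characters are complex; $\mathrm{Irr}(G)$ is the set of irreducible characters of $G$, $Z(G)$ is the center of $G$, and $[G,G]$ is the commutator subgroup of $G$. For a normal subgroup $N\lhd G$, let $\mathrm{Irr}(G\mid N)=\{\chi\in\mathrm{Irr}(G): N\nleq\ker(\chi)\}$, and let $V(G\mid N)$ be the subgroup of $G$ generated by all $g\in G$ such that $\chi(g)\neq 0$ for some $\chi\in\mathrm{Irr}(G\mid N)$. For $N\lhd G$, let $U(G\mid N)=\prod H$, the product of all normal subgroups $H\lhd G$ satisfying $V(G\mid H)\le N$. Put $U(G)=U(G\mid Z(G))$. A group $G$ is a VZ-group if every nonlinear irreducible character of $G$ vanishes on $G\setminus Z(G)$.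
   Formalization: The group G is assumed to be nonabelian or trivial; for a nontrivial abelian G the claim is false, since G is vacuously a VZ-group and U(G)=G while [G,G]=1. *)

theory Defs
  imports
    "HOL-Algebra.Generated_Groups"
    "HOL-Algebra.FiniteProduct"
    "HOL-Algebra.SndIsomorphismGrp"
    "Jordan_Normal_Form.VS_Connect"
begin

definition matrix_rep :: "('a, 'b) monoid_scheme \<Rightarrow> nat \<Rightarrow> ('a \<Rightarrow> complex mat) \<Rightarrow> bool" where
  "matrix_rep G n \<rho> \<longleftrightarrow> \<rho> \<in> hom G (units_of (ring_mat TYPE(complex) n ()))"

definition irreducible_rep :: "('a, 'b) monoid_scheme \<Rightarrow> nat \<Rightarrow> ('a \<Rightarrow> complex mat) \<Rightarrow> bool" where
  "irreducible_rep G n \<rho> \<longleftrightarrow> matrix_rep G n \<rho> \<and> n > 0 \<and>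
     (\<forall>W. VectorSpace.subspace class_ring W (module_vec TYPE(complex) n) \<and>
          (\<forall>g \<in> carrier G. \<forall>w \<in> W. \<rho> g *\<^sub>v w \<in> W)
        \<longrightarrow> W = {0\<^sub>v n} \<or> W = carrier_vec n)"

definition mat_trace :: "complex mat \<Rightarrow> complex" where
  "mat_trace A = sum_list (diag_mat A)"

text \<open>Characters are functions on \<open>carrier G\<close>; they are made \<open>undefined\<close> elsewhere.\<close>

definition rep_char :: "('a, 'b) monoid_scheme \<Rightarrow> ('a \<Rightarrow> complex mat) \<Rightarrow> 'a \<Rightarrow> complex" where
  "rep_char G \<rho> = (\<lambda>g \<in> carrier G. mat_trace (\<rho> g))"

definition Irr :: "('a, 'b) monoid_scheme \<Rightarrow> ('a \<Rightarrow> complex) set" where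
  "Irr G = {rep_char G \<rho> | n \<rho>. irreducible_rep G n \<rho>}"

definition char_ker :: "('a, 'b) monoid_scheme \<Rightarrow> ('a \<Rightarrow> complex) \<Rightarrow> 'a set" where
  "char_ker G \<chi> = {g \<in> carrier G. \<chi> g = \<chi> \<one>\<^bsub>G\<^esub>}"

definition Irr_over :: "('a, 'b) monoid_scheme \<Rightarrow> 'a set \<Rightarrow> ('a \<Rightarrow> complex) set" where
  "Irr_over G N = {\<chi> \<in> Irr G. \<not> N \<subseteq> char_ker G \<chi>}"

definition V_rel :: "('a, 'b) monoid_scheme \<Rightarrow> 'a set \<Rightarrow> 'a set" where
  "V_rel G N = generate G {g \<in> carrier G. \<exists>\<chi> \<in> Irr_over G N. \<chi> g \<noteq> 0}"

text \<open>
  A product of finitely many normal subgroups is a \<open>finprod\<close> in the commutative monoid of normal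
  subgroups under \<open>set_mult\<close>.
\<close>

definition normal_monoid :: "('a, 'b) monoid_scheme \<Rightarrow> 'a set monoid" where
  "normal_monoid G = \<lparr>carrier = {H. H \<lhd> G}, monoid.mult = set_mult G, one = {\<one>\<^bsub>G\<^esub>}\<rparr>"

lemma (in group) comm_monoid_normal_monoid: "comm_monoid (normal_monoid G)"
proof -
  have sub: "H \<subseteq> carrier G" if "H \<lhd> G" for H
    using that by (simp add: normal_imp_subgroup subgroup.subset)
  have comm: "H <#> K = K <#> H" if H: "H \<lhd> G" and K: "K \<lhd> G" for H K
    using commut_normal[OF normal_imp_subgroup[OF H] K] by simp
  have closed: "H <#> K \<lhd> G" if H: "H \<lhd> G" and K: "K \<lhd> G" for H K
  proof (rule normal_invI)
    show "subgroup (H <#> K) G"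
      using H normal_imp_subgroup[OF K]
      by (intro second_isomorphism_grp.normal_set_mult_subgroup)
        (simp add: second_isomorphism_grp_def second_isomorphism_grp_axioms_def)
  next
    fix x h
    assume x: "x \<in> carrier G" and "h \<in> H <#> K"
    then obtain a b where a: "a \<in> H" and b: "b \<in> K" and h: "h = a \<otimes> b"
      by (auto simp: set_mult_def)
    have ab: "a \<in> carrier G" "b \<in> carrier G"
      using a b sub H K by auto
    have cancel: "inv x \<otimes> (x \<otimes> y) = y" if "y \<in> carrier G" for y
      using x that by (simp add: m_assoc [symmetric])
    have "x \<otimes> h \<otimes> inv x = (x \<otimes> a \<otimes> inv x) \<otimes> (x \<otimes> b \<otimes> inv x)"
      using x ab by (simp add: h m_assoc cancel)
    moreover have "x \<otimes> a \<otimes> inv x \<in> H" "x \<otimes> b \<otimes> inv x \<in> K"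
      using H K x a b by (auto intro: normal.inv_op_closed2)
    ultimately show "x \<otimes> h \<otimes> inv x \<in> H <#> K"
      by (auto simp: set_mult_def)
  qed
  show ?thesis
  proof (rule comm_monoidI)
    fix H K L
    assume "H \<in> carrier (normal_monoid G)" "K \<in> carrier (normal_monoid G)"
      "L \<in> carrier (normal_monoid G)"
    then show "H \<otimes>\<^bsub>normal_monoid G\<^esub> K \<otimes>\<^bsub>normal_monoid G\<^esub> L =
        H \<otimes>\<^bsub>normal_monoid G\<^esub> (K \<otimes>\<^bsub>normal_monoid G\<^esub> L)"
      by (simp add: normal_monoid_def set_mult_assoc sub)
  next
    fix H
    assume "H \<in> carrier (normal_monoid G)"
    then have "H \<subseteq> carrier G"
      using sub by (simp add: normal_monoid_def)
    then show "\<one>\<^bsub>normal_monoid G\<^esub> \<otimes>\<^bsub>normal_monoid G\<^esub> H = H"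
      by (auto simp: normal_monoid_def set_mult_def subset_iff)
  next
    fix H K
    assume "H \<in> carrier (normal_monoid G)" "K \<in> carrier (normal_monoid G)"
    then show "H \<otimes>\<^bsub>normal_monoid G\<^esub> K = K \<otimes>\<^bsub>normal_monoid G\<^esub> H"
      using comm by (simp add: normal_monoid_def)
  qed (simp_all add: normal_monoid_def closed one_is_normal)
qed

definition U_rel :: "('a, 'b) monoid_scheme \<Rightarrow> 'a set \<Rightarrow> 'a set" where
  "U_rel G N = finprod (normal_monoid G) (\<lambda>H. H) {H. H \<lhd> G \<and> V_rel G H \<subseteq> N}"

definition center :: "('a, 'b) monoid_scheme \<Rightarrow> 'a set" where
  "center G = {z \<in> carrier G. \<forall>g \<in> carrier G. z \<otimes>\<^bsub>G\<^esub> g = g \<otimes>\<^bsub>G\<^esub> z}"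

definition U_group :: "('a, 'b) monoid_scheme \<Rightarrow> 'a set" where
  "U_group G = U_rel G (center G)"

text \<open>
  Every abelian group is a VZ-group in this sense. For a finite abelian \<open>G\<close> one has
  \<open>U_group G = carrier G\<close>, which is different from the commutator subgroup unless \<open>G\<close> is trivial.
\<close>

definition VZ_group :: "('a, 'b) monoid_scheme \<Rightarrow> bool" where
  "VZ_group G \<longleftrightarrow>
     (\<forall>\<chi> \<in> Irr G. \<chi> \<one>\<^bsub>G\<^esub> \<noteq> 1 \<longrightarrow> (\<forall>g \<in> carrier G - center G. \<chi> g = 0))"

end

theory Submission
  imports Defs "Jordan_Normal_Form.Spectral_Radius" "HOL-Algebra.Multiplicative_Group"
begin

text \<open>
  Write \<open>Z\<close> for the center and \<open>G'\<close> for the commutator subgroup of \<open>G\<close>. A normal subgroup \<open>H\<close>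
  satisfies \<open>V(G|H) \<le> Z\<close> exactly when every irreducible character whose kernel does not contain
  \<open>H\<close> vanishes off \<open>Z\<close>, so \<open>U(G)\<close> is the join of all normal subgroups with this property. The
  link with VZ-groups is that an irreducible character is linear if and only if its kernel
  contains \<open>G'\<close>.

  If \<open>G\<close> is a VZ-group, then the characters in \<open>Irr(G|G')\<close> are nonlinear, hence vanish off \<open>Z\<close>,
  and \<open>G' \<le> U(G)\<close>. For the other inclusion, let \<open>H\<close> be normal and not contained in \<open>G'\<close>. Linear
  characters separate the points of \<open>G/G'\<close>, so some linear character is nontrivial on \<open>H\<close>. It has
  no zeros, whence \<open>V(G|H) = G\<close>. For nonabelian \<open>G\<close> this is not contained in \<open>Z\<close>, and so every
  factor \<open>H\<close> of \<open>U(G)\<close> lies in \<open>G'\<close>.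

  Conversely, let \<open>U(G) = G'\<close> and let \<open>\<chi>\<close> be a nonlinear irreducible character. Its kernel does not
  contain \<open>G' = U(G)\<close>; since the kernel of a representation is a subgroup, some factor \<open>H\<close>
  of the product \<open>U(G)\<close> is not contained in it. So \<open>\<chi>\<close> lies in \<open>Irr(G|H)\<close> and vanishes off \<open>V(G|H) \<le> Z\<close>.

  Three facts about characters carry the argument. The lemma
  \<open>normal_subset_char_ker_imp_trivial\<close> identifies, on normal subgroups, the kernel read off from
  the character values with the kernel of the representation. The lemma
  \<open>derived_trivial_imp_degree_1\<close> is Schur's lemma for commuting matrices. The lemma
  \<open>ex_multiplicative_neq_1_off_derived\<close> supplies the linear characters, by extending characters
  of a finite abelian group one cyclic step at a time.
\<close>

section \<open>Linear characters of finite abelian groups\<close>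

text \<open>
  Linear characters of a subgroup \<open>K\<close>, with unspecified values outside \<open>K\<close>: an extension to a
  larger subgroup is another function that agrees with the first on \<open>K\<close>. Normalising the value at the identity excludes the zero function, so
  all values on a subgroup are nonzero.
\<close>

definition multiplicative_on :: "('a, 'b) monoid_scheme \<Rightarrow> 'a set \<Rightarrow> ('a \<Rightarrow> complex) \<Rightarrow> bool" where
  "multiplicative_on G K \<phi> \<longleftrightarrow>
     \<phi> \<one>\<^bsub>G\<^esub> = 1 \<and> (\<forall>x\<in>K. \<forall>y\<in>K. \<phi> (x \<otimes>\<^bsub>G\<^esub> y) = \<phi> x * \<phi> y)"

lemma (in group) pow_closed_subgroup:
  assumes "subgroup K G" and "x \<in> K"
  shows "x [^] (n::nat) \<in> K"
  using assms by (induction n) (auto simp: subgroup.one_closed subgroup.m_closed)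

lemma (in group) multiplicative_on_pow:
  assumes K: "subgroup K G" and \<phi>: "multiplicative_on G K \<phi>" and x: "x \<in> K"
  shows "\<phi> (x [^] (n::nat)) = \<phi> x ^ n"
proof (induction n)
  case 0
  show ?case using \<phi> by (simp add: multiplicative_on_def)
next
  case (Suc n)
  have "x [^] n \<in> K"
    using pow_closed_subgroup[OF K x] .
  then show ?case using \<phi> x Suc by (simp add: multiplicative_on_def)
qed

text \<open>
  The number \<open>m\<close> is the order of \<open>x\<close> modulo \<open>K\<close>: the least positive exponent that leads into \<open>K\<close>
  divides all others, by division with remainder.
\<close>

lemma (in group) ex_pow_mem_iff_dvd:
  assumes fin: "finite (carrier G)" and K: "subgroup K G" and x: "x \<in> carrier G"
  shows "\<exists>m>0. \<forall>i::nat. x [^] i \<in> K \<longleftrightarrow> m dvd i"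
proof -
  define m where "m = (LEAST i::nat. 0 < i \<and> x [^] i \<in> K)"
  have pos: "0 < ord x" using ord_ge_1[OF fin x] by simp
  have "0 < ord x \<and> x [^] ord x \<in> K"
    using pos x subgroup.one_closed[OF K] by simp
  then have m: "0 < m" "x [^] m \<in> K"
    unfolding m_def by (metis (mono_tags, lifting) LeastI)+
  have mult: "x [^] (m * q) \<in> K" for q :: nat
    using pow_closed_subgroup[OF K m(2), of q] x
    by (simp add: nat_pow_pow)
  have "m dvd i" if i: "x [^] i \<in> K" for i :: nat
  proof -
    have "x [^] i = x [^] (m * (i div m)) \<otimes> x [^] (i mod m)"
      using x by (simp add: nat_pow_mult)
    then have "x [^] (i mod m) = inv (x [^] (m * (i div m))) \<otimes> x [^] i"
      using x by (simp add: inv_solve_left)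
    then have "x [^] (i mod m) \<in> K"
      using K i mult by (simp add: subgroup.m_closed subgroup.m_inv_closed)
    moreover have "i mod m < m" using m by simp
    ultimately have "i mod m = 0"
      unfolding m_def using not_less_Least by (metis (mono_tags, lifting) neq0_conv)
    then show ?thesis by auto
  qed
  then show ?thesis using m(1) mult by (metis dvd_def)
qed

text \<open>
  With \<open>m\<close> the order of \<open>x\<close> modulo \<open>K\<close>, the only relation between \<open>x\<close> and \<open>K\<close> is the one that
  determines \<open>x [^] m\<close>. Hence \<open>x\<close> may be sent to any \<open>c\<close> that respects it, and \<open>k \<otimes> x [^] i\<close> then
  goes to \<open>\<phi> k * c ^ i\<close>. That \<open>c\<close> may be chosen freely is what later produces a value different
  from 1.
\<close>

lemma (in comm_group) extend_multiplicative:
  assumes fin: "finite (carrier G)" and K: "subgroup K G" and \<phi>: "multiplicative_on G K \<phi>"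
    and x: "x \<in> carrier G" and m: "\<And>i::nat. x [^] i \<in> K \<longleftrightarrow> m dvd i"
    and c: "c ^ m = \<phi> (x [^] m)"
  obtains K' \<mu> where "subgroup K' G" "K \<subseteq> K'" "x \<in> K'" "multiplicative_on G K' \<mu>"
    "\<And>k. k \<in> K \<Longrightarrow> \<mu> k = \<phi> k" "\<mu> x = c"
proof -
  have sub: "k \<in> carrier G" if "k \<in> K" for k using that K by (rule subgroup.mem_carrier[rotated])
  define K' where "K' = K <#> generate G {x}"
  have mem: "y \<in> K' \<longleftrightarrow> (\<exists>k\<in>K. \<exists>i::nat. y = k \<otimes> x [^] i)" for y
    unfolding K'_def generate_pow_on_finite_carrier[OF fin x] set_mult_def by auto
  have pow: "\<phi> (x [^] (m * q)) = c ^ (m * q)" for q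
  proof -
    have "x [^] m \<in> K" using m by simp
    from multiplicative_on_pow[OF K \<phi> this, of q] show ?thesis
      using x c by (simp add: nat_pow_pow power_mult)
  qed
  \<comment> \<open>Two expressions of the same element differ by a power of \<open>x\<close> that lies in \<open>K\<close>; its exponent
      is a multiple of \<open>m\<close>, and there \<open>\<phi>\<close> agrees with the powers of \<open>c\<close>.\<close>
  have indep_le: "\<phi> k * c ^ i = \<phi> l * c ^ j"
    if kl: "k \<in> K" "l \<in> K" and eq: "k \<otimes> x [^] i = l \<otimes> x [^] j" and le: "i \<le> j" for k l and i j :: nat
  proof -
    obtain d where d: "j = d + i" using le by (metis le_Suc_ex add.commute)
    have "k \<otimes> x [^] i = (l \<otimes> x [^] d) \<otimes> x [^] i"
      using eq d x kl sub by (simp add: nat_pow_mult m_assoc)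
    then have k: "k = l \<otimes> x [^] d" using x kl sub by simp
    then have xd: "x [^] d = inv l \<otimes> k" using x kl sub by (simp add: inv_solve_left)
    then have dK: "x [^] d \<in> K" using kl K by (simp add: subgroup.m_closed subgroup.m_inv_closed)
    then obtain q where "d = m * q" using m by (auto elim: dvdE)
    then have "\<phi> (x [^] d) = c ^ d" using pow by simp
    then have "\<phi> k = \<phi> l * c ^ d" using k \<phi> kl dK by (simp add: multiplicative_on_def)
    then show ?thesis by (simp add: d power_add)
  qed
  have indep: "\<phi> k * c ^ i = \<phi> l * c ^ j"
    if "k \<in> K" "l \<in> K" "k \<otimes> x [^] i = l \<otimes> x [^] j" for k l and i j :: nat
    using indep_le[of k l i j] indep_le[of l k j i] that by (metis nat_le_linear)
  define \<mu> where "\<mu> y = (THE z. \<exists>k\<in>K. \<exists>i::nat. y = k \<otimes> x [^] i \<and> z = \<phi> k * c ^ i)" for y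
  have \<mu>: "\<mu> (k \<otimes> x [^] i) = \<phi> k * c ^ i" if "k \<in> K" for k and i :: nat
    unfolding \<mu>_def using that by (intro the_equality) (auto intro: indep)
  have one: "\<one> \<in> K" using K by (rule subgroup.one_closed)
  have \<phi>1: "\<phi> \<one> = 1" using \<phi> by (simp add: multiplicative_on_def)
  have \<mu>K: "\<mu> k = \<phi> k" if "k \<in> K" for k using \<mu>[OF that, of 0] that sub by simp
  have \<mu>x: "\<mu> x = c" using \<mu>[OF one, of 1] x \<phi>1 by simp
  have "multiplicative_on G K' \<mu>"
    unfolding multiplicative_on_def
  proof (intro conjI ballI)
    show "\<mu> \<one> = 1" using \<mu>K[OF one] \<phi>1 by simp
  next
    fix y z assume "y \<in> K'" "z \<in> K'"
    then obtain k l and i j :: nat where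
      kl: "k \<in> K" "l \<in> K" and y: "y = k \<otimes> x [^] i" and z: "z = l \<otimes> x [^] j" by (auto simp: mem)
    have "y \<otimes> z = (k \<otimes> l) \<otimes> x [^] (i + j)"
      unfolding y z using kl sub x by (simp add: nat_pow_mult[symmetric] m_ac)
    moreover have "k \<otimes> l \<in> K" using K kl by (simp add: subgroup.m_closed)
    ultimately show "\<mu> (y \<otimes> z) = \<mu> y * \<mu> z"
      using \<phi> kl \<mu> by (simp add: y z multiplicative_on_def power_add)
  qed
  moreover have "subgroup K' G"
    unfolding K'_def using K x by (intro mult_subgroups generate_is_subgroup) auto
  moreover have "k \<in> K'" if "k \<in> K" for k
    unfolding mem using that sub by (intro bexI[of _ k] exI[of _ "0::nat"]) auto
  moreover have "x \<in> K'"
    unfolding mem using one x by (intro bexI[of _ \<one>] exI[of _ "1::nat"]) auto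
  ultimately show ?thesis using that \<mu>K \<mu>x by blast
qed

lemma (in comm_group) extend_multiplicative_to_carrier:
  assumes fin: "finite (carrier G)" and "subgroup K G" and "multiplicative_on G K \<phi>"
  shows "\<exists>\<mu>. multiplicative_on G (carrier G) \<mu> \<and> (\<forall>k\<in>K. \<mu> k = \<phi> k)"
  using assms(2,3)
proof (induction "card (carrier G - K)" arbitrary: K \<phi> rule: less_induct)
  case less
  note K = less.prems(1) and \<phi> = less.prems(2)
  show ?case
  proof (cases "K = carrier G")
    case True
    then show ?thesis using \<phi> by blast
  next
    case False
    then obtain x where x: "x \<in> carrier G" "x \<notin> K" using subgroup.subset[OF K] by blast
    obtain m where m: "m > 0" "\<And>i::nat. x [^] i \<in> K \<longleftrightarrow> m dvd i"
      using ex_pow_mem_iff_dvd[OF fin K x(1)] by blast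
    obtain c where c: "c ^ m = \<phi> (x [^] m)"
    proof (cases "\<phi> (x [^] m) = 0")
      case True
      then show ?thesis using that[of 0] m(1) by simp
    next
      case False
      from card_nth_roots[OF this m(1)] have "{z. z ^ m = \<phi> (x [^] m)} \<noteq> {}"
        using m(1) by (intro notI) simp
      then show ?thesis using that by blast
    qed
    obtain K' \<mu> where K': "subgroup K' G" "K \<subseteq> K'" "x \<in> K'" "multiplicative_on G K' \<mu>"
      and \<mu>: "\<And>k. k \<in> K \<Longrightarrow> \<mu> k = \<phi> k"
      using extend_multiplicative[OF fin K \<phi> x(1) m(2) c] by metis
    have "card (carrier G - K') < card (carrier G - K)"
      using fin x K' by (intro psubset_card_mono) auto
    then show ?thesis using less.hyps[OF _ K'(1,4)] K'(2) \<mu> by (metis subsetD)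
  qed
qed

text \<open>
  Starting from the trivial subgroup, the first extension step may send \<open>a\<close> to any \<open>ord a\<close>-th root
  of unity, and there is one besides 1 because \<open>a\<close> has order at least 2.
\<close>

lemma (in comm_group) ex_multiplicative_neq_1:
  assumes fin: "finite (carrier G)" and a: "a \<in> carrier G" "a \<noteq> \<one>"
  shows "\<exists>\<mu>. multiplicative_on G (carrier G) \<mu> \<and> \<mu> a \<noteq> 1"
proof -
  have "ord a > 0" using ord_ge_1[OF fin a(1)] by simp
  moreover have "ord a \<noteq> 1" using a ord_eq_1 by simp
  ultimately have "card {z::complex. z ^ ord a = 1} > card {1::complex}"
    by (simp add: card_roots_unity_eq)
  then obtain c :: complex where c: "c ^ ord a = 1" "c \<noteq> 1"
    by (metis (mono_tags, lifting) card_mono finite.emptyI finite_insert insertCI mem_Collect_eq not_less subsetI)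
  obtain K \<mu> where K: "subgroup K G" "a \<in> K" "multiplicative_on G K \<mu>" "\<mu> a = c"
  proof (rule extend_multiplicative[OF fin triv_subgroup _ a(1), of "\<lambda>_. 1" "ord a" c])
    show "multiplicative_on G {\<one>} (\<lambda>_. 1)" by (simp add: multiplicative_on_def)
  qed (use a c in \<open>auto simp: pow_eq_id\<close>)
  then show ?thesis using extend_multiplicative_to_carrier[OF fin K(1,3)] c by metis
qed

text \<open>The characters of the finite abelian quotient by the commutator subgroup, pulled back.\<close>

lemma (in group) ex_multiplicative_neq_1_off_derived:
  assumes fin: "finite (carrier G)" and a: "a \<in> carrier G" "a \<notin> derived G (carrier G)"
  shows "\<exists>\<mu>. multiplicative_on G (carrier G) \<mu> \<and> \<mu> a \<noteq> 1"
proof -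
  define D where "D = derived G (carrier G)"
  interpret D: normal D G unfolding D_def by (rule derived_is_normal[OF normal_self])
  interpret Q: comm_group "G Mod D" unfolding D_def by (rule derived_quot_is_comm_group)
  have "finite (carrier (G Mod D))"
    using fin by (simp add: FactGroup_def RCOSETS_def)
  moreover have "D #> a \<in> carrier (G Mod D)" using a by (auto simp: FactGroup_def RCOSETS_def)
  moreover have "D #> a \<noteq> \<one>\<^bsub>G Mod D\<^esub>"
    using a rcos_self[OF a(1) D.subgroup_axioms] by (auto simp: FactGroup_def D_def)
  ultimately obtain \<mu> where \<mu>: "multiplicative_on (G Mod D) (carrier (G Mod D)) \<mu>" "\<mu> (D #> a) \<noteq> 1"
    using Q.ex_multiplicative_neq_1 by blast
  have "multiplicative_on G (carrier G) (\<lambda>g. \<mu> (D #> g))"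
    using \<mu>(1) D.subset
    by (auto simp: multiplicative_on_def FactGroup_def RCOSETS_def D.rcos_sum[symmetric] coset_mult_one)
  then show ?thesis using \<mu>(2) by blast
qed

section \<open>Kernels of irreducible representations\<close>

lemma matrix_repD:
  fixes G (structure)
  assumes "group G" and "matrix_rep G n \<rho>"
  shows "\<And>g. g \<in> carrier G \<Longrightarrow> \<rho> g \<in> carrier_mat n n"
    and "\<And>g h. g \<in> carrier G \<Longrightarrow> h \<in> carrier G \<Longrightarrow> \<rho> (g \<otimes> h) = \<rho> g * \<rho> h"
    and "\<rho> \<one> = 1\<^sub>m n"
proof -
  let ?R = "ring_mat TYPE(complex) n ()"
  interpret R: ring ?R by (rule ring_mat)
  have hom: "\<rho> \<in> hom G (units_of ?R)" using assms(2) by (simp add: matrix_rep_def)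
  show "\<rho> g \<in> carrier_mat n n" if "g \<in> carrier G" for g
    using hom_in_carrier[OF hom that] by (auto simp: units_of_carrier Units_def ring_mat_simps)
  show "\<rho> (g \<otimes> h) = \<rho> g * \<rho> h" if "g \<in> carrier G" "h \<in> carrier G" for g h
    using hom_mult[OF hom that] by (simp add: units_of_mult ring_mat_simps)
  show "\<rho> \<one> = 1\<^sub>m n"
    using hom_one[OF hom assms(1) R.units_group] by (simp add: units_of_one ring_mat_simps)
qed

lemma subspace_module_vec_iff:
  fixes W :: "complex vec set"
  shows "VectorSpace.subspace class_ring W (module_vec TYPE(complex) n) \<longleftrightarrow>
    W \<subseteq> carrier_vec n \<and> 0\<^sub>v n \<in> W \<and> (\<forall>v\<in>W. \<forall>w\<in>W. v + w \<in> W) \<and> (\<forall>c. \<forall>v\<in>W. c \<cdot>\<^sub>v v \<in> W)"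
  using vec_vs[of n, where 'a = complex] vec_module[of n, where 'a = complex]
  by (auto simp: VectorSpace.subspace_def LinearCombinations.submodule_def module_vec_simps class_ring_simps)

lemma irreducible_rep_invariant:
  assumes "irreducible_rep G n \<rho>" and "W \<subseteq> carrier_vec n" and "0\<^sub>v n \<in> W"
    and "\<And>v w. v \<in> W \<Longrightarrow> w \<in> W \<Longrightarrow> v + w \<in> W" and "\<And>c v. v \<in> W \<Longrightarrow> c \<cdot>\<^sub>v v \<in> W"
    and "\<And>g w. g \<in> carrier G \<Longrightarrow> w \<in> W \<Longrightarrow> \<rho> g *\<^sub>v w \<in> W"
  shows "W = {0\<^sub>v n} \<or> W = carrier_vec n"
proof -
  have "VectorSpace.subspace class_ring W (module_vec TYPE(complex) n)"
    unfolding subspace_module_vec_iff using assms(2-5) by blast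
  moreover have "\<forall>g\<in>carrier G. \<forall>w\<in>W. \<rho> g *\<^sub>v w \<in> W" using assms(6) by blast
  ultimately show ?thesis using assms(1) by (simp add: irreducible_rep_def)
qed

lemma mat_eqI_mult_vec:
  fixes A B :: "complex mat"
  assumes A: "A \<in> carrier_mat n n" and B: "B \<in> carrier_mat n n"
    and eq: "\<And>v. v \<in> carrier_vec n \<Longrightarrow> A *\<^sub>v v = B *\<^sub>v v"
  shows "A = B"
proof (rule mat_col_eqI)
  fix j assume "j < dim_col B"
  then have j: "j < n" using B by simp
  have "col C j = C *\<^sub>v unit_vec n j" if "C \<in> carrier_mat n n" for C :: "complex mat"
    using that j by (intro eq_vecI) auto
  then show "col A j = col B j" using eq[of "unit_vec n j"] A B by simp
qed (use A B in auto)

lemma mat_trace_sum: "A \<in> carrier_mat n n \<Longrightarrow> mat_trace A = (\<Sum>i<n. A $$ (i, i))"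
  by (simp add: mat_trace_def diag_mat_def interv_sum_list_conv_sum_set_nat atLeast0LessThan)

lemma mat_trace_one: "mat_trace (1\<^sub>m n) = of_nat n"
  by (simp add: mat_trace_sum[of _ n])

lemma rep_char_one:
  assumes "group G" "matrix_rep G n \<rho>"
  shows "rep_char G \<rho> \<one>\<^bsub>G\<^esub> = of_nat n"
  using matrix_repD(3)[OF assms] assms(1)
  by (simp add: rep_char_def mat_trace_one group.is_monoid monoid.one_closed)

lemma (in group) subgroup_rep_kernel:
  assumes rep: "matrix_rep G n \<rho>"
  shows "subgroup {g \<in> carrier G. \<rho> g = 1\<^sub>m n} G"
proof (rule subgroupI)
  note \<rho> = matrix_repD[OF is_group rep]
  show "inv g \<in> {g \<in> carrier G. \<rho> g = 1\<^sub>m n}" if "g \<in> {g \<in> carrier G. \<rho> g = 1\<^sub>m n}" for g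
    using that \<rho>(1)[of "inv g"] \<rho>(2)[of "inv g" g] \<rho>(3) by auto
qed (use matrix_repD[OF is_group rep] in auto)

text \<open>
  Because \<open>H\<close> is normal, its fixed vectors form an invariant subspace, so \<open>H\<close> acts trivially unless
  only the zero vector is fixed. In that case the sum of \<open>\<rho> k\<close> over \<open>k \<in> H\<close> is zero, since its
  columns are fixed by \<open>H\<close>. Its trace is however \<open>card H * n\<close>, as all elements of \<open>H\<close> have trace
  \<open>n\<close>. This use of irreducibility avoids the eigenvalues of the individual matrices.
\<close>

lemma (in group) normal_subset_char_ker_imp_trivial:
  assumes fin: "finite (carrier G)" and irr: "irreducible_rep G n \<rho>"
    and H: "H \<lhd> G" and ker: "H \<subseteq> char_ker G (rep_char G \<rho>)" and h: "h \<in> H"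
  shows "\<rho> h = 1\<^sub>m n"
proof -
  interpret H: normal H G by (rule H)
  have rep: "matrix_rep G n \<rho>" and n: "n > 0" using irr by (auto simp: irreducible_rep_def)
  note \<rho> = matrix_repD[OF is_group rep]
  have sub: "k \<in> carrier G" if "k \<in> H" for k using that H.subset by auto
  define W where "W = {v \<in> carrier_vec n. \<forall>k\<in>H. \<rho> k *\<^sub>v v = v}"
  have inv: "\<rho> g *\<^sub>v v \<in> W" if g: "g \<in> carrier G" and v: "v \<in> W" for g v
  proof -
    have vc: "v \<in> carrier_vec n" and vk: "\<And>k. k \<in> H \<Longrightarrow> \<rho> k *\<^sub>v v = v"
      using v by (auto simp: W_def)
    have "\<rho> k *\<^sub>v (\<rho> g *\<^sub>v v) = \<rho> g *\<^sub>v v" if k: "k \<in> H" for k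
    proof -
      have k': "inv g \<otimes> k \<otimes> g \<in> H" using H.inv_op_closed1[OF g k] .
      have "k \<otimes> g = g \<otimes> (inv g \<otimes> k \<otimes> g)"
        using g sub[OF k] by (simp add: m_assoc[symmetric])
      then have eq: "\<rho> k * \<rho> g = \<rho> g * \<rho> (inv g \<otimes> k \<otimes> g)"
        using \<rho>(2)[OF sub[OF k] g] \<rho>(2)[OF g sub[OF k']] by simp
      have "\<rho> k *\<^sub>v (\<rho> g *\<^sub>v v) = (\<rho> k * \<rho> g) *\<^sub>v v"
        using \<rho>(1)[OF sub[OF k]] \<rho>(1)[OF g] vc by simp
      also have "\<dots> = \<rho> g *\<^sub>v (\<rho> (inv g \<otimes> k \<otimes> g) *\<^sub>v v)"
        unfolding eq using \<rho>(1)[OF g] \<rho>(1)[OF sub[OF k']] vc by simp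
      finally show ?thesis using vk[OF k'] by simp
    qed
    then show ?thesis using \<rho>(1)[OF g] vc by (auto simp: W_def)
  qed
  have "W = {0\<^sub>v n} \<or> W = carrier_vec n"
  proof (rule irreducible_rep_invariant[OF irr _ _ _ _ inv])
    have "\<rho> k *\<^sub>v 0\<^sub>v n = 0\<^sub>v n" if "k \<in> H" for k
      using \<rho>(1)[OF sub[OF that]] by auto
    then show "0\<^sub>v n \<in> W" by (simp add: W_def)
    show "v + w \<in> W" if "v \<in> W" "w \<in> W" for v w
      using that \<rho>(1) sub by (auto simp: W_def mult_add_distrib_mat_vec[of _ n n])
    show "c \<cdot>\<^sub>v v \<in> W" if "v \<in> W" for c v
      using that \<rho>(1) sub by (auto simp: W_def mult_mat_vec[of _ n n])
  qed (auto simp: W_def)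
  moreover have "W \<noteq> {0\<^sub>v n}"
  proof
    assume W: "W = {0\<^sub>v n}"
    have diag: "(\<Sum>k\<in>H. \<rho> k $$ (j, j)) = 0" if j: "j < n" for j
    proof -
      \<comment> \<open>column \<open>j\<close> of the sum of the matrices \<open>\<rho> k\<close>\<close>
      define v where "v = vec n (\<lambda>i. \<Sum>k\<in>H. \<rho> k $$ (i, j))"
      have "\<rho> l *\<^sub>v v = v" if l: "l \<in> H" for l
      proof (rule eq_vecI)
        fix i assume "i < dim_vec v"
        then have i: "i < n" by (simp add: v_def)
        have "(\<rho> l *\<^sub>v v) $ i = (\<Sum>m<n. \<rho> l $$ (i, m) * (\<Sum>k\<in>H. \<rho> k $$ (m, j)))"
          using \<rho>(1)[OF sub[OF l]] i by (simp add: v_def scalar_prod_def atLeast0LessThan)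
        also have "\<dots> = (\<Sum>k\<in>H. \<Sum>m<n. \<rho> l $$ (i, m) * \<rho> k $$ (m, j))"
          unfolding sum_distrib_left by (rule sum.swap)
        also have "\<dots> = (\<Sum>k\<in>H. \<rho> (l \<otimes> k) $$ (i, j))"
        proof (rule sum.cong[OF refl])
          fix k assume k: "k \<in> H"
          show "(\<Sum>m<n. \<rho> l $$ (i, m) * \<rho> k $$ (m, j)) = \<rho> (l \<otimes> k) $$ (i, j)"
            using \<rho>(1)[OF sub[OF l]] \<rho>(1)[OF sub[OF k]] i j
            by (simp add: \<rho>(2)[OF sub[OF l] sub[OF k]] scalar_prod_def atLeast0LessThan)
        qed
        also have "\<dots> = (\<Sum>k\<in>H. \<rho> k $$ (i, j))"
        proof (rule sum.reindex_bij_witness[where i = "\<lambda>k. inv l \<otimes> k" and j = "\<lambda>k. l \<otimes> k"])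
          fix k assume k: "k \<in> H"
          show "inv l \<otimes> (l \<otimes> k) = k" "l \<otimes> (inv l \<otimes> k) = k"
            using sub[OF l] sub[OF k] by (simp_all add: m_assoc[symmetric])
          show "l \<otimes> k \<in> H" "inv l \<otimes> k \<in> H" using l k by simp_all
        qed simp
        finally show "(\<rho> l *\<^sub>v v) $ i = v $ i" using i by (simp add: v_def)
      qed (use \<rho>(1)[OF sub[OF l]] in \<open>simp add: v_def\<close>)
      then have "v \<in> W" by (auto simp: W_def v_def)
      then have "v $ j = 0" using W j by simp
      then show ?thesis using j by (simp add: v_def)
    qed
    have "mat_trace (\<rho> k) = of_nat n" if "k \<in> H" for k
      using ker that sub rep_char_one[OF is_group rep] by (auto simp: char_ker_def rep_char_def)
    then have "of_nat (card H) * of_nat n = (\<Sum>k\<in>H. mat_trace (\<rho> k))" by simp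
    also have "\<dots> = (\<Sum>k\<in>H. \<Sum>i<n. \<rho> k $$ (i, i))"
      using \<rho>(1) sub by (intro sum.cong) (auto intro!: mat_trace_sum)
    also have "\<dots> = 0" by (subst sum.swap) (simp add: diag)
    finally show False
      using n h finite_subset[OF H.subset fin] by auto
  qed
  ultimately have "\<rho> h *\<^sub>v v = v" if "v \<in> carrier_vec n" for v using that h by (auto simp: W_def)
  then show ?thesis using \<rho>(1) sub[OF h] by (intro mat_eqI_mult_vec[of _ n]) auto
qed

text \<open>
  The image of \<open>\<rho>\<close> is commutative, so an eigenspace of any \<open>\<rho> g\<close> is invariant and hence the whole
  space. All \<open>\<rho> g\<close> are therefore scalar, every line is invariant, and the space is a line.
\<close>

lemma (in group) derived_trivial_imp_degree_1:
  assumes irr: "irreducible_rep G n \<rho>"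
    and triv: "\<And>d. d \<in> derived G (carrier G) \<Longrightarrow> \<rho> d = 1\<^sub>m n"
  shows "n = 1"
proof -
  have rep: "matrix_rep G n \<rho>" and n: "n > 0" using irr by (auto simp: irreducible_rep_def)
  note \<rho> = matrix_repD[OF is_group rep]
  have comm: "\<rho> g * \<rho> h = \<rho> h * \<rho> g" if g: "g \<in> carrier G" and h: "h \<in> carrier G" for g h
  proof -
    let ?d = "g \<otimes> h \<otimes> inv g \<otimes> inv h"
    have d: "?d \<in> derived G (carrier G)"
      unfolding derived_def using g h by (intro generate.incl) auto
    have "g \<otimes> h = ?d \<otimes> (h \<otimes> g)"
      using g h by (simp add: m_assoc inv_solve_left')
    then have "\<rho> (g \<otimes> h) = \<rho> ?d * \<rho> (h \<otimes> g)" using \<rho>(2)[of ?d "h \<otimes> g"] g h by simp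
    then show ?thesis
      using triv[OF d] \<rho>(1)[OF g] \<rho>(1)[OF h] \<rho>(2)[OF g h] \<rho>(2)[OF h g] by simp
  qed
  have scalar: "\<exists>c. \<forall>v\<in>carrier_vec n. \<rho> g *\<^sub>v v = c \<cdot>\<^sub>v v" if g: "g \<in> carrier G" for g
  proof -
    obtain c where "eigenvalue (\<rho> g) c"
      using spectrum_non_empty[OF \<rho>(1)[OF g] n] by (auto simp: spectrum_def)
    then obtain u where u: "u \<in> carrier_vec n" "u \<noteq> 0\<^sub>v n" "\<rho> g *\<^sub>v u = c \<cdot>\<^sub>v u"
      using \<rho>(1)[OF g] by (auto simp: eigenvalue_def eigenvector_def)
    define W where "W = {v \<in> carrier_vec n. \<rho> g *\<^sub>v v = c \<cdot>\<^sub>v v}"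
    have "W = {0\<^sub>v n} \<or> W = carrier_vec n"
    proof (rule irreducible_rep_invariant[OF irr])
      show "0\<^sub>v n \<in> W" using \<rho>(1)[OF g] by (auto simp: W_def)
      show "v + w \<in> W" if "v \<in> W" "w \<in> W" for v w
        using that \<rho>(1)[OF g] by (auto simp: W_def mult_add_distrib_mat_vec[of _ n n] smult_add_distrib_vec[of _ n])
      show "a \<cdot>\<^sub>v v \<in> W" if "v \<in> W" for a v
        using that \<rho>(1)[OF g] by (auto simp: W_def mult_mat_vec[of _ n n] smult_smult_assoc mult.commute)
      show "\<rho> h *\<^sub>v w \<in> W" if h: "h \<in> carrier G" and w: "w \<in> W" for h w
      proof -
        have wc: "w \<in> carrier_vec n" "\<rho> g *\<^sub>v w = c \<cdot>\<^sub>v w" using w by (auto simp: W_def)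
        have "\<rho> g *\<^sub>v (\<rho> h *\<^sub>v w) = (\<rho> g * \<rho> h) *\<^sub>v w"
          using \<rho>(1)[OF g] \<rho>(1)[OF h] wc(1) by simp
        also have "\<dots> = \<rho> h *\<^sub>v (\<rho> g *\<^sub>v w)"
          unfolding comm[OF g h] using \<rho>(1)[OF g] \<rho>(1)[OF h] wc(1) by simp
        finally have "\<rho> g *\<^sub>v (\<rho> h *\<^sub>v w) = \<rho> h *\<^sub>v (\<rho> g *\<^sub>v w)" .
        then show ?thesis using wc \<rho>(1)[OF h] by (auto simp: W_def mult_mat_vec[of _ n n])
      qed
    qed (auto simp: W_def)
    then have "W = carrier_vec n" using u by (auto simp: W_def)
    then show ?thesis by (auto simp: W_def)
  qed
  \<comment> \<open>the line spanned by the first unit vector; it contains the last one only if \<open>n = 1\<close>\<close>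
  define L where "L = {v :: complex vec. v \<in> carrier_vec n \<and> (\<forall>i<n. 0 < i \<longrightarrow> v $ i = 0)}"
  have "L = {0\<^sub>v n} \<or> L = carrier_vec n"
  proof (rule irreducible_rep_invariant[OF irr])
    show "\<rho> g *\<^sub>v w \<in> L" if "g \<in> carrier G" "w \<in> L" for g w
      using scalar[OF that(1)] that(2) by (auto simp: L_def)
  qed (auto simp: L_def)
  moreover have "unit_vec n 0 \<in> L" using n by (auto simp: L_def)
  moreover have "unit_vec n 0 \<noteq> (0\<^sub>v n :: complex vec)" using n by (metis index_unit_vec(1) index_zero_vec(1) zero_neq_one)
  ultimately have "L = carrier_vec n" by auto
  then have "unit_vec n (n - 1) \<in> L" by simp
  then have "n - 1 = 0" using n by (auto simp: L_def split: if_splits)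
  then show "n = 1" using n by simp
qed

lemma (in group) degree_1_imp_derived_subset_char_ker:
  assumes rep: "matrix_rep G 1 \<rho>"
  shows "derived G (carrier G) \<subseteq> char_ker G (rep_char G \<rho>)"
proof -
  note \<rho> = matrix_repD[OF is_group rep]
  have comm: "A * B = B * A" if "A \<in> carrier_mat 1 1" "B \<in> carrier_mat 1 1" for A B :: "complex mat"
    using that by (intro eq_matI) (auto simp: scalar_prod_def)
  have "subgroup {g \<in> carrier G. \<rho> g = 1\<^sub>m 1} G" by (rule subgroup_rep_kernel[OF rep])
  moreover have "\<rho> (g \<otimes> h \<otimes> inv g \<otimes> inv h) = 1\<^sub>m 1" if g: "g \<in> carrier G" and h: "h \<in> carrier G" for g h
  proof -
    have "\<rho> (g \<otimes> h \<otimes> inv g \<otimes> inv h) = \<rho> (g \<otimes> h) * \<rho> (inv g \<otimes> inv h)"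
      using g h \<rho>(2)[of "g \<otimes> h" "inv g \<otimes> inv h"] by (simp add: m_assoc)
    also have "\<rho> (g \<otimes> h) = \<rho> (h \<otimes> g)" 
      using comm[OF \<rho>(1)[OF g] \<rho>(1)[OF h]] \<rho>(2)[OF g h] \<rho>(2)[OF h g] by simp
    also have "\<rho> (h \<otimes> g) * \<rho> (inv g \<otimes> inv h) = \<rho> ((h \<otimes> g) \<otimes> (inv g \<otimes> inv h))"
      
      using g h \<rho>(2)[of "h \<otimes> g" "inv g \<otimes> inv h"] by simp
    also have "(h \<otimes> g) \<otimes> (inv g \<otimes> inv h) = \<one>" using g h by (simp add: inv_mult_group[symmetric])
    finally show ?thesis using \<rho>(3) by simp
  qed
  ultimately have "derived G (carrier G) \<subseteq> {g \<in> carrier G. \<rho> g = 1\<^sub>m 1}"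
    unfolding derived_def by (intro generate_subgroup_incl) auto
  then show ?thesis by (auto simp: char_ker_def rep_char_def \<rho>(3))
qed

section \<open>Linear characters and vanishing subgroups\<close>

lemma (in group) multiplicative_in_Irr:
  assumes \<phi>: "multiplicative_on G (carrier G) \<phi>"
  shows "restrict \<phi> (carrier G) \<in> Irr G"
proof -
  let ?R = "ring_mat TYPE(complex) 1 ()"
  define \<rho> where "\<rho> g = mat 1 1 (\<lambda>_. \<phi> g)" for g
  have mult: "\<rho> (g \<otimes> h) = \<rho> g * \<rho> h" if "g \<in> carrier G" "h \<in> carrier G" for g h
    using that \<phi> by (intro eq_matI) (auto simp: \<rho>_def multiplicative_on_def scalar_prod_def)
  have one: "\<rho> \<one> = 1\<^sub>m 1" using \<phi> by (intro eq_matI) (auto simp: \<rho>_def multiplicative_on_def)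
  have dim: "\<rho> g \<in> carrier_mat 1 1" for g by (simp add: \<rho>_def)
  have "\<rho> g \<in> Units ?R" if "g \<in> carrier G" for g
    using that dim mult[of g "inv g"] mult[of "inv g" g] one
    by (auto simp: Units_def ring_mat_simps intro!: bexI[of _ "\<rho> (inv g)"])
  then have rep: "matrix_rep G 1 \<rho>"
    using mult by (auto simp: matrix_rep_def hom_def units_of_carrier units_of_mult ring_mat_simps)
  have "W = {0\<^sub>v 1} \<or> W = carrier_vec 1"
    if W: "VectorSpace.subspace class_ring W (module_vec TYPE(complex) 1)" for W
  proof (cases "W \<subseteq> {0\<^sub>v 1}")
    case True
    then show ?thesis using W by (auto simp: subspace_module_vec_iff)
  next
    case False
    then obtain w where w: "w \<in> W" "w \<noteq> 0\<^sub>v 1" by blast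
    then have wc: "w \<in> carrier_vec 1" using W by (auto simp: subspace_module_vec_iff)
    then have w0: "w $ 0 \<noteq> 0" using w(2) by auto
    have "v \<in> W" if v: "v \<in> carrier_vec 1" for v
    proof -
      have "v = (v $ 0 / w $ 0) \<cdot>\<^sub>v w" using v wc w0 by (intro eq_vecI) auto
      then show ?thesis using W w(1) by (metis subspace_module_vec_iff)
    qed
    then show ?thesis using W by (auto simp: subspace_module_vec_iff)
  qed
  then have "irreducible_rep G 1 \<rho>" using rep by (auto simp: irreducible_rep_def)
  moreover have "rep_char G \<rho> = restrict \<phi> (carrier G)"
    by (auto simp: rep_char_def \<rho>_def mat_trace_sum[of _ 1] restrict_def)
  ultimately show ?thesis unfolding Irr_def by (metis (mono_tags, lifting) mem_Collect_eq)
qed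

lemma (in group) multiplicative_on_nonzero:
  assumes \<phi>: "multiplicative_on G (carrier G) \<phi>" and g: "g \<in> carrier G"
  shows "\<phi> g \<noteq> 0"
proof
  assume "\<phi> g = 0"
  moreover have "\<phi> (g \<otimes> inv g) = \<phi> g * \<phi> (inv g)" and "\<phi> \<one> = 1"
    using \<phi> g unfolding multiplicative_on_def by blast+
  ultimately show False using g by simp
qed

text \<open>A linear character that is nontrivial on \<open>H\<close> has no zeros, so every element is a generator.\<close>

lemma (in group) not_subset_derived_imp_V_rel_eq_carrier:
  assumes fin: "finite (carrier G)" and H: "H \<subseteq> carrier G" "\<not> H \<subseteq> derived G (carrier G)"
  shows "V_rel G H = carrier G"
proof -
  obtain a where a: "a \<in> H" "a \<notin> derived G (carrier G)" using H by blast
  obtain \<phi> where \<phi>: "multiplicative_on G (carrier G) \<phi>" "\<phi> a \<noteq> 1"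
    using ex_multiplicative_neq_1_off_derived[OF fin] a H by blast
  let ?\<chi> = "restrict \<phi> (carrier G)"
  have "\<phi> \<one> = 1" using \<phi>(1) by (simp add: multiplicative_on_def)
  then have "a \<notin> char_ker G ?\<chi>" using \<phi>(2) by (simp add: char_ker_def)
  then have \<chi>: "?\<chi> \<in> Irr_over G H"
    using a multiplicative_in_Irr[OF \<phi>(1)] by (auto simp: Irr_over_def)
  have "carrier G \<subseteq> V_rel G H"
  proof
    fix g assume g: "g \<in> carrier G"
    then have "?\<chi> g \<noteq> 0" using multiplicative_on_nonzero[OF \<phi>(1) g] by simp
    then show "g \<in> V_rel G H"
      unfolding V_rel_def using g \<chi> by (blast intro: generate.incl)
  qed
  moreover have "V_rel G H \<subseteq> carrier G" unfolding V_rel_def by (rule generate_incl) auto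
  ultimately show ?thesis by blast
qed

section \<open>Products of normal subgroups\<close>

text \<open>
  The product of finitely many normal subgroups is their join in the lattice of subgroups. This
  universal property is all that is used of the product.
\<close>

lemma (in group) finprod_normal_monoid_subset_iff:
  assumes fin: "finite F" and F: "\<And>H. H \<in> F \<Longrightarrow> H \<lhd> G" and K: "subgroup K G"
  shows "finprod (normal_monoid G) (\<lambda>H. H) F \<subseteq> K \<longleftrightarrow> (\<forall>H\<in>F. H \<subseteq> K)"
  using fin F
proof (induction F)
  interpret N: comm_monoid "normal_monoid G" by (rule comm_monoid_normal_monoid)
  case empty
  have "finprod (normal_monoid G) (\<lambda>H. H) {} = {\<one>}"
    by (simp only: N.finprod_empty) (simp add: normal_monoid_def)
  then show ?case using subgroup.one_closed[OF K] by simp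
next
  interpret N: comm_monoid "normal_monoid G" by (rule comm_monoid_normal_monoid)
  case (insert H F)
  let ?P = "finprod (normal_monoid G) (\<lambda>H. H) F"
  have H: "H \<lhd> G" using insert.prems by blast
  have carr: "(\<lambda>H. H) \<in> F \<rightarrow> carrier (normal_monoid G)" "H \<in> carrier (normal_monoid G)"
    using insert.prems by (auto simp: normal_monoid_def)
  have P: "?P \<lhd> G" using N.finprod_closed[OF carr(1)] by (simp add: normal_monoid_def)
  have "finprod (normal_monoid G) (\<lambda>H. H) (insert H F) = H <#> ?P"
    using N.finprod_insert[OF insert.hyps carr] by (simp add: normal_monoid_def)
  moreover have "H <#> ?P \<subseteq> K \<longleftrightarrow> H \<subseteq> K \<and> ?P \<subseteq> K"
  proof -
    interpret H: normal H G by (rule H)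
    interpret P: normal ?P G by (rule P)
    have "h \<in> H <#> ?P" if "h \<in> H" for h
      unfolding set_mult_def using that P.one_closed H.subset
      by (intro UN_I[of h] UN_I[of \<one>]) auto
    moreover have "p \<in> H <#> ?P" if "p \<in> ?P" for p
      unfolding set_mult_def using that H.one_closed P.subset
      by (intro UN_I[of \<one>] UN_I[of p]) auto
    moreover have "H <#> ?P \<subseteq> K" if "H \<subseteq> K" "?P \<subseteq> K"
      unfolding set_mult_def using that K by (auto intro: subgroup.m_closed)
    ultimately show ?thesis by blast
  qed
  ultimately show ?case using insert by simp
qed

lemma (in group) subgroup_center: "subgroup (center G) G"
proof (rule subgroupI)
  show "inv z \<in> center G" if "z \<in> center G" for z
    unfolding center_def
  proof (intro CollectI conjI ballI)
    have z: "z \<in> carrier G" using that by (simp add: center_def)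
    then show "inv z \<in> carrier G" by simp
    fix g assume g: "g \<in> carrier G"
    have "z \<otimes> g = g \<otimes> z" using that g by (simp add: center_def)
    then have "g = inv z \<otimes> (g \<otimes> z)" using z g by (simp add: inv_solve_left)
    then show "inv z \<otimes> g = g \<otimes> inv z" using z g by (simp add: inv_solve_right m_assoc)
  qed
  show "y \<otimes> z \<in> center G" if y: "y \<in> center G" and z: "z \<in> center G" for y z
    unfolding center_def
  proof (intro CollectI conjI ballI)
    have yz: "y \<in> carrier G" "z \<in> carrier G" using y z by (simp_all add: center_def)
    then show "y \<otimes> z \<in> carrier G" by simp
    fix g assume g: "g \<in> carrier G"
    have "y \<otimes> z \<otimes> g = y \<otimes> (g \<otimes> z)" using z g yz by (simp add: center_def m_assoc)
    also have "\<dots> = (g \<otimes> y) \<otimes> z" using y g yz by (simp add: center_def m_assoc[symmetric])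
    finally show "y \<otimes> z \<otimes> g = g \<otimes> (y \<otimes> z)" using g yz by (simp add: m_assoc)
  qed
qed (auto simp: center_def)

lemma (in group) U_group_subset_iff:
  assumes fin: "finite (carrier G)" and K: "subgroup K G"
  shows "U_group G \<subseteq> K \<longleftrightarrow> (\<forall>H. H \<lhd> G \<and> V_rel G H \<subseteq> center G \<longrightarrow> H \<subseteq> K)"
proof -
  let ?F = "{H. H \<lhd> G \<and> V_rel G H \<subseteq> center G}"
  have "?F \<subseteq> Pow (carrier G)" by (auto dest: normal_imp_subgroup subgroup.subset)
  then have "finite ?F" using fin by (simp add: finite_subset)
  then have "finprod (normal_monoid G) (\<lambda>H. H) ?F \<subseteq> K \<longleftrightarrow> (\<forall>H\<in>?F. H \<subseteq> K)"
    by (rule finprod_normal_monoid_subset_iff[OF _ _ K]) simp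
  then show ?thesis unfolding U_group_def U_rel_def by simp
qed

lemma (in group) subgroup_U_group: "subgroup (U_group G) G"
proof -
  interpret N: comm_monoid "normal_monoid G" by (rule comm_monoid_normal_monoid)
  have "U_group G \<in> carrier (normal_monoid G)"
    unfolding U_group_def U_rel_def by (rule N.finprod_closed) (auto simp: normal_monoid_def)
  then show ?thesis by (simp add: normal_monoid_def normal_imp_subgroup)
qed

section \<open>The characterization of VZ-groups\<close>

theorem theorem1:
  fixes G (structure)
  assumes "group G" and "finite (carrier G)"
    and "\<not> comm_group G \<or> carrier G = {\<one>}"
  shows "VZ_group G \<longleftrightarrow> U_group G = derived G (carrier G)"
proof -
  interpret group G by (rule assms(1))
  let ?D = "derived G (carrier G)"
  have D: "?D \<lhd> G" by (rule derived_is_normal[OF normal_self])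
  have sD: "subgroup ?D G" by (rule normal_imp_subgroup[OF D])
  show ?thesis
  proof
    assume VZ: "VZ_group G"
    have "\<chi> \<one> \<noteq> 1" if \<chi>: "\<chi> \<in> Irr_over G ?D" for \<chi>
    proof
      assume 1: "\<chi> \<one> = 1"
      obtain n \<rho> where \<rho>: "irreducible_rep G n \<rho>" "\<chi> = rep_char G \<rho>"
        using \<chi> by (auto simp: Irr_over_def Irr_def)
      then have rep: "matrix_rep G n \<rho>" by (simp add: irreducible_rep_def)
      then have "n = 1" using rep_char_one[OF is_group rep] 1 \<rho>(2) by simp
      then show False
        using degree_1_imp_derived_subset_char_ker rep \<chi> \<rho>(2) by (auto simp: Irr_over_def)
    qed
    then have "\<chi> g = 0" if "\<chi> \<in> Irr_over G ?D" "g \<in> carrier G" "g \<notin> center G" for \<chi> g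
      using VZ that by (auto simp: VZ_group_def Irr_over_def)
    then have "V_rel G ?D \<subseteq> center G"
      unfolding V_rel_def by (intro generate_subgroup_incl subgroup_center) blast
    then have "?D \<subseteq> U_group G"
      using U_group_subset_iff[OF assms(2) subgroup_U_group] D by blast
    moreover have "H \<subseteq> ?D" if H: "H \<lhd> G" "V_rel G H \<subseteq> center G" for H
    proof (rule ccontr)
      assume *: "\<not> H \<subseteq> ?D"
      have sub: "H \<subseteq> carrier G" using H(1) by (simp add: normal_imp_subgroup subgroup.subset)
      \<comment> \<open>This makes \<open>G\<close> abelian, hence trivial by hypothesis, and then \<open>H\<close> does lie in \<open>?D\<close>.\<close>
      have "carrier G \<subseteq> center G"
        using not_subset_derived_imp_V_rel_eq_carrier[OF assms(2) sub *] H(2) by simp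
      then have "x \<otimes> y = y \<otimes> x" if "x \<in> carrier G" "y \<in> carrier G" for x y
        using that unfolding center_def by blast
      then have "comm_group G" by (rule group_comm_groupI)
      then have "H \<subseteq> {\<one>}" using assms(3) sub by simp
      then show False using * subgroup.one_closed[OF sD] by blast
    qed
    then have "U_group G \<subseteq> ?D" using U_group_subset_iff[OF assms(2) sD] by blast
    ultimately show "U_group G = ?D" by blast
  next
    assume U: "U_group G = ?D"
    show "VZ_group G"
      unfolding VZ_group_def
    proof (intro ballI impI)
      fix \<chi> g assume \<chi>: "\<chi> \<in> Irr G" "\<chi> \<one> \<noteq> 1" and g: "g \<in> carrier G - center G"
      obtain n \<rho> where \<rho>: "irreducible_rep G n \<rho>" "\<chi> = rep_char G \<rho>"
        using \<chi> by (auto simp: Irr_def)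
      then have rep: "matrix_rep G n \<rho>" by (simp add: irreducible_rep_def)
      \<comment> \<open>The kernel of \<open>\<rho>\<close> is visibly a subgroup, so it can be compared with a product of subgroups;
          this is not apparent for the set on which \<open>\<chi>\<close> takes the value \<open>\<chi> \<one>\<close>.\<close>
      let ?K = "{g \<in> carrier G. \<rho> g = 1\<^sub>m n}"
      have "n \<noteq> 1" using rep_char_one[OF is_group rep] \<chi>(2) \<rho>(2) by auto
      then have "\<not> U_group G \<subseteq> ?K"
        using derived_trivial_imp_degree_1[OF \<rho>(1)] U by blast
      moreover have "subgroup ?K G" by (rule subgroup_rep_kernel[OF rep])
      ultimately obtain H where H: "H \<lhd> G" "V_rel G H \<subseteq> center G" "\<not> H \<subseteq> ?K"
        unfolding U_group_subset_iff[OF assms(2) \<open>subgroup ?K G\<close>] by blast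
      have "H \<subseteq> carrier G" using H(1) by (simp add: normal_imp_subgroup subgroup.subset)
      then have "\<not> H \<subseteq> char_ker G \<chi>"
        using normal_subset_char_ker_imp_trivial[OF assms(2) \<rho>(1) H(1)] H(3) \<rho>(2) by blast
      then have "\<chi> \<in> Irr_over G H" using \<chi>(1) by (simp add: Irr_over_def)
      then have "\<chi> g \<noteq> 0 \<Longrightarrow> g \<in> V_rel G H"
        unfolding V_rel_def using g by (intro generate.incl) blast
      then show "\<chi> g = 0" using H(2) g by blast
    qed
  qed
qed

end
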